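(* Let $\lambda\in(0,1)$, let $b_1<b_2<\cdots<b_n$ be real numbers, and let $E_{\lambda,\mathbf{b}}$ be the self-similar set of the iterated function system $\{f_i(x)=\lambda x+b_i\}_{i=1}^n$. If the strong separation condition fails for $E_{\lambda,\mathbf{b}}$, then $E_{\lambda,\mathbf{b}}$ contains a three-term arithmetic progression.
   Context: For $\mathbf{b}=\{b_i\}_{i=1}^n$ with $b_1<\cdots<b_n$ and $\lambda\in(0,1)$, $E_{\lambda,\mathbf{b}}$ denotes the unique nonempty compact set $E\subset\mathbb{R}$ with $E=\bigcup_{i=1}^n(\lambda E+b_i)$. The strong separation condition holds for $E_{\lambda,\mathbf{b}}$ if the sets $f_i(E_{\lambda,\mathbf{b}})$, $i=1,\dots,n$, are pairwise disjoint. A three-term arithmetic progression is a set $\{a,a+\delta,a+2\delta\}$ with $a\in\mathbb{R}$ and $\delta>0$. *)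

theory Defs
  imports "HOL-Analysis.Analysis" "HOL-Library.Disjoint_Sets"
begin

definition ifs_map :: "real \<Rightarrow> (nat \<Rightarrow> real) \<Rightarrow> nat \<Rightarrow> real \<Rightarrow> real" where
  "ifs_map lam b i x = lam * x + b i"

definition is_self_similar_set :: "real \<Rightarrow> nat \<Rightarrow> (nat \<Rightarrow> real) \<Rightarrow> real set \<Rightarrow> bool" where
  "is_self_similar_set lam n b E \<longleftrightarrow>
     E \<noteq> {} \<and> compact E \<and> E = (\<Union>i\<in>{1..n}. ifs_map lam b i ` E)"

(* The definite description is justified by ex1_self_similar_set below
   (for 0 < lam < 1 and n \<ge> 1). *)
definition self_similar_set :: "real \<Rightarrow> nat \<Rightarrow> (nat \<Rightarrow> real) \<Rightarrow> real set" where
  "self_similar_set lam n b = (THE E. is_self_similar_set lam n b E)"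

definition strong_separation :: "real \<Rightarrow> nat \<Rightarrow> (nat \<Rightarrow> real) \<Rightarrow> bool" where
  "strong_separation lam n b \<longleftrightarrow>
     disjoint_family_on (\<lambda>i. ifs_map lam b i ` self_similar_set lam n b) {1..n}"

definition three_term_AP :: "real set \<Rightarrow> bool" where
  "three_term_AP P \<longleftrightarrow> (\<exists>a \<delta>. \<delta> > 0 \<and> P = {a, a + \<delta>, a + 2 * \<delta>})"

lemma self_similar_set_subset:
  assumes l: "0 < lam" "lam < 1"
    and A: "is_self_similar_set lam n b A" and B: "is_self_similar_set lam n b B"
  shows "A \<subseteq> B"
proof -
  have cA: "compact A" "A \<noteq> {}" and cB: "compact B" "B \<noteq> {}"
    using A B by (auto simp: is_self_similar_set_def)
  have Aeq: "A = (\<Union>i\<in>{1..n}. ifs_map lam b i ` A)"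
    and Beq: "B = (\<Union>i\<in>{1..n}. ifs_map lam b i ` B)"
    using A B unfolding is_self_similar_set_def by blast+
  have "continuous_on A (\<lambda>x. infdist x B)"
    by (intro continuous_intros)
  then obtain a where a: "a \<in> A" "\<And>x. x \<in> A \<Longrightarrow> infdist x B \<le> infdist a B"
    using continuous_attains_sup[OF cA] by blast
  obtain i a' where i: "i \<in> {1..n}" "a' \<in> A" "a = ifs_map lam b i a'"
    using a(1) Aeq by blast
  obtain y where y: "y \<in> B" "infdist a' B = dist a' y"
    using infdist_attains_inf[OF compact_imp_closed[OF cB(1)] cB(2)] by blast
  have "ifs_map lam b i y \<in> B" using Beq i(1) y(1) by blast
  then have "infdist a B \<le> dist a (ifs_map lam b i y)" by (rule infdist_le)
  also have "\<dots> = \<bar>lam * (a' - y)\<bar>"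
    unfolding i(3) ifs_map_def dist_real_def by (simp add: algebra_simps)
  also have "\<dots> = lam * infdist a' B"
    using l y(2) by (simp add: abs_mult dist_real_def)
  also have "\<dots> \<le> lam * infdist a B"
    using a(2)[OF i(2)] l by (intro mult_left_mono) auto
  finally have "(1 - lam) * infdist a B \<le> 0" by (simp add: algebra_simps)
  then have "infdist a B \<le> 0" using l by (simp add: mult_le_0_iff)
  then have "infdist x B = 0" if "x \<in> A" for x
    using a(2)[OF that] infdist_nonneg[of x B] by linarith
  then show ?thesis
    using in_closed_iff_infdist_zero[OF compact_imp_closed[OF cB(1)] cB(2)] by blast
qed

lemma ex_self_similar_set:
  assumes l: "0 < lam" "lam < 1" and n: "1 \<le> n"
  shows "\<exists>E. is_self_similar_set lam n b E"
proof -
  define F where "F X = (\<Union>i\<in>{1..n}. ifs_map lam b i ` X)" for X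
  define M where "M = (\<Sum>i\<in>{1..n}. \<bar>b i\<bar>)"
  have M: "\<bar>b i\<bar> \<le> M" if "i \<in> {1..n}" for i
    unfolding M_def using that by (intro member_le_sum) auto
  have M0: "0 \<le> M" unfolding M_def by (simp add: sum_nonneg)
  define R where "R = M / (1 - lam)"
  have R: "M = (1 - lam) * R" "0 \<le> R" using l M0 by (auto simp: R_def)
  define K where "K m = (F ^^ m) {-R..R}" for m
  have KS: "K (Suc m) = F (K m)" for m by (simp add: K_def)
  have mono: "F X \<subseteq> F Y" if "X \<subseteq> Y" for X Y using that by (auto simp: F_def)
  have cpt: "compact (K m)" for m
  proof (induction m)
    case 0 then show ?case by (simp add: K_def)
  next
    case (Suc m)
    have "continuous_on (K m) (ifs_map lam b i)" for i
      unfolding ifs_map_def by (intro continuous_intros)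
    then show ?case
      unfolding KS F_def using Suc by (intro compact_UN compact_continuous_image) auto
  qed
  have ne: "K m \<noteq> {}" for m
  proof (induction m)
    case 0 then show ?case using R by (simp add: K_def)
  next
    case (Suc m) then show ?case using n unfolding KS F_def by fastforce
  qed
  have base: "F {-R..R} \<subseteq> {-R..R}"
  proof
    fix y assume "y \<in> F {-R..R}"
    then obtain i x where ix: "i \<in> {1..n}" "x \<in> {-R..R}" "y = lam * x + b i"
      by (auto simp: F_def ifs_map_def)
    have "\<bar>y\<bar> \<le> lam * \<bar>x\<bar> + \<bar>b i\<bar>"
      using l unfolding ix(3) by (metis abs_mult abs_of_pos abs_triangle_ineq)
    also have "\<dots> \<le> lam * R + M"
      using ix(2) M[OF ix(1)] l by (intro add_mono mult_left_mono) auto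
    also have "\<dots> = R" using R(1) by (simp add: algebra_simps)
    finally show "y \<in> {-R..R}" by auto
  qed
  have dec1: "K (Suc m) \<subseteq> K m" for m
  proof (induction m)
    case 0 then show ?case using base by (simp add: K_def)
  next
    case (Suc m) then show ?case using mono unfolding KS by blast
  qed
  have dec: "K q \<subseteq> K m" if "m \<le> q" for m q
    using lift_Suc_antimono_le[of K, OF dec1 that] .
  define E where "E = (\<Inter>m. K m)"
  have "E \<noteq> {}" unfolding E_def by (rule compact_nest) (use cpt ne dec in auto)
  moreover have "compact E"
    unfolding E_def using cpt by (intro compact_Inter) auto
  moreover have "E = F E"
  proof
    show "F E \<subseteq> E"
    proof -
      have "F E \<subseteq> K m" for m
        using mono[of E "K m"] dec1[of m] unfolding KS E_def by blast
      then show ?thesis by (auto simp: E_def)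
    qed
    show "E \<subseteq> F E"
    proof
      fix x assume x: "x \<in> E"
      define g where "g i = (x - b i) / lam" for i
      show "x \<in> F E"
      proof (rule ccontr)
        assume "x \<notin> F E"
        moreover have "ifs_map lam b i (g i) = x" for i
          using l by (simp add: g_def ifs_map_def)
        ultimately have "\<forall>i\<in>{1..n}. g i \<notin> E" unfolding F_def by (metis UN_I imageI)
        then have "\<forall>i\<in>{1..n}. \<exists>m. g i \<notin> K m" by (auto simp: E_def)
        then obtain N where N: "\<forall>i\<in>{1..n}. g i \<notin> K (N i)" by metis
        define L where "L = (\<Sum>i\<in>{1..n}. N i)"
        have L: "g i \<notin> K L" if "i \<in> {1..n}" for i
        proof -
          have "N i \<le> L" unfolding L_def using that by (intro member_le_sum) auto
          then show ?thesis using dec N that by blast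
        qed
        have "x \<in> K (Suc L)" using x by (auto simp: E_def)
        then obtain i z where iz: "i \<in> {1..n}" "z \<in> K L" "x = lam * z + b i"
          unfolding KS F_def ifs_map_def by blast
        have "g i = z" using iz(3) l by (simp add: g_def)
        then show False using L iz by blast
      qed
    qed
  qed
  ultimately show ?thesis unfolding is_self_similar_set_def F_def by blast
qed

lemma ex1_self_similar_set:
  assumes "0 < lam" "lam < 1" "1 \<le> n"
  shows "\<exists>!E. is_self_similar_set lam n b E"
  using ex_self_similar_set[OF assms] self_similar_set_subset[OF assms(1,2)]
  by (metis subset_antisym)

end

theory Submission
  imports Defs
begin

text \<open>
  Suppose that two first-level pieces of the attractor \<open>E\<close> meet: \<open>f\<^sub>i x = f\<^sub>j y\<close> with
  \<open>i < j\<close> and \<open>x, y \<in> E\<close>. Then \<open>lam * (x - y) = b j - b i\<close>: after scaling by \<open>lam\<close>, the gap between \<open>y\<close> and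
  \<open>x\<close> is exactly the shift between the maps \<open>f\<^sub>i\<close> and \<open>f\<^sub>j\<close>.
  Hence \<open>f\<^sub>i\<close> and \<open>f\<^sub>j\<close> send the pair to two pairs of gap \<open>b j - b i\<close>, and these share the
  point \<open>f\<^sub>i x = f\<^sub>j y\<close>. The three points \<open>f\<^sub>i y\<close>, \<open>f\<^sub>i x = f\<^sub>j y\<close>, \<open>f\<^sub>j x\<close> of \<open>E\<close> form the
  progression.
\<close>

lemma is_self_similar_set_self_similar_set:
  assumes "0 < lam" "lam < 1" "1 \<le> n"
  shows "is_self_similar_set lam n b (self_similar_set lam n b)"
  unfolding self_similar_set_def by (rule theI'[OF ex1_self_similar_set[OF assms]])

lemma ifs_map_in_self_similar_set:
  assumes "is_self_similar_set lam n b E" "i \<in> {1..n}" "x \<in> E"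
  shows "ifs_map lam b i x \<in> E"
  using assms unfolding is_self_similar_set_def by blast

lemma three_term_AP_ifs_map_images:
  assumes "b i < b j" and "ifs_map lam b i x = ifs_map lam b j y"
  shows "three_term_AP {ifs_map lam b i y, ifs_map lam b i x, ifs_map lam b j x}"
proof -
  have "ifs_map lam b i x = ifs_map lam b i y + (b j - b i)"
    and "ifs_map lam b j x = ifs_map lam b i y + 2 * (b j - b i)"
    using assms(2) by (simp_all add: ifs_map_def)
  moreover have "b j - b i > 0"
    using assms(1) by simp
  ultimately show ?thesis
    unfolding three_term_AP_def by metis
qed

lemma not_strong_separationE:
  assumes "\<not> strong_separation lam n b"
  obtains i j x y where "i \<in> {1..n}" "j \<in> {1..n}" "i < j"
    "x \<in> self_similar_set lam n b" "y \<in> self_similar_set lam n b"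
    "ifs_map lam b i x = ifs_map lam b j y"
proof -
  obtain i j x y where "i \<in> {1..n}" "j \<in> {1..n}" "i \<noteq> j"
    "x \<in> self_similar_set lam n b" "y \<in> self_similar_set lam n b"
    "ifs_map lam b i x = ifs_map lam b j y"
    using assms unfolding strong_separation_def disjoint_family_on_def by blast
  then show thesis
    using that[of i j x y] that[of j i y x] by (metis linorder_neqE_nat)
qed

theorem proposition1p2:
  fixes lam :: real and n :: nat and b :: "nat \<Rightarrow> real"
  assumes "0 < lam" and "lam < 1"
    and "1 \<le> n"
    and "strict_mono_on {1..n} b"
    and "\<not> strong_separation lam n b"
  shows "\<exists>P. three_term_AP P \<and> P \<subseteq> self_similar_set lam n b"
proof -
  let ?E = "self_similar_set lam n b"
  obtain i j x y where ij: "i \<in> {1..n}" "j \<in> {1..n}" "i < j"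
    and xy: "x \<in> ?E" "y \<in> ?E" and meet: "ifs_map lam b i x = ifs_map lam b j y"
    using not_strong_separationE[OF assms(5)] by metis
  have "b i < b j"
    using strict_mono_onD[OF assms(4) ij] .
  then have "three_term_AP {ifs_map lam b i y, ifs_map lam b i x, ifs_map lam b j x}"
    using meet by (rule three_term_AP_ifs_map_images)
  moreover have "{ifs_map lam b i y, ifs_map lam b i x, ifs_map lam b j x} \<subseteq> ?E"
    using ifs_map_in_self_similar_set[OF is_self_similar_set_self_similar_set[OF assms(1-3)]]
      ij xy by simp
  ultimately show ?thesis by blast
qed

end
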